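(* Every abelian quandle generated by two elements is subquandle separable.
   Context: A quandle is a set $X$ with a binary operation $*$ such that: (1) $x*x=x$ for all $x$; (2) for all $x,y \in X$ there is a unique $z\in X$ with $x=z*y$ (written $z=x*^{-1}y$); (3) $(x*y)*z=(x*z)*(y*z)$ for all $x,y,z$. A quandle $X$ is abelian if the group $\mathrm{Inn}(X)$ generated by the automorphisms $S_x:y\mapsto y*x$ ($x\in X$) is abelian; equivalently, $(x*y)*z=(x*z)*y$ for all $x,y,z\in X$. A subquandle is a subset closed under $*$ and $*^{-1}$; it is generated by a set $S$ if it is the smallest subquandle containing $S$, and finitely generated if $S$ can be taken finite. A subset $S$ of a quandle $X$ is separable in $X$ if for each $x\in X\setminus S$ there exist a finite quandle $F$ and a quandle homomorphism $\phi:X\to F$ with $\phi(x)\notin\phi(S)$. A quandle is subquandle separable if each of its finitely generated subquandles is separable. *)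

theory Defs
  imports "HOL-Algebra.Bij" "HOL-Algebra.Generated_Groups"
begin

text \<open>A quandle is given by a carrier set \<open>X\<close> and an operation that is only relevant on \<open>X\<close>.
  The empty carrier is allowed.\<close>

locale quandle =
  fixes X :: "'a set" and qop :: "'a \<Rightarrow> 'a \<Rightarrow> 'a" (infixl "\<triangleleft>" 70)
  assumes closed: "x \<in> X \<Longrightarrow> y \<in> X \<Longrightarrow> x \<triangleleft> y \<in> X"
    and idem: "x \<in> X \<Longrightarrow> x \<triangleleft> x = x"
    and ex1_divisor: "x \<in> X \<Longrightarrow> y \<in> X \<Longrightarrow> \<exists>!z. z \<in> X \<and> x = z \<triangleleft> y"
    and self_distrib: "x \<in> X \<Longrightarrow> y \<in> X \<Longrightarrow> z \<in> X \<Longrightarrow> (x \<triangleleft> y) \<triangleleft> z = (x \<triangleleft> z) \<triangleleft> (y \<triangleleft> z)"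

definition qinv :: "'a set \<Rightarrow> ('a \<Rightarrow> 'a \<Rightarrow> 'a) \<Rightarrow> 'a \<Rightarrow> 'a \<Rightarrow> 'a" where
  "qinv X qop x y = (THE z. z \<in> X \<and> x = qop z y)"

text \<open>The translation \<open>S\<^sub>x : y \<mapsto> y * x\<close>, restricted to \<open>X\<close> because elements of \<^const>\<open>BijGroup\<close>
  are extensional functions.\<close>

definition translation :: "'a set \<Rightarrow> ('a \<Rightarrow> 'a \<Rightarrow> 'a) \<Rightarrow> 'a \<Rightarrow> 'a \<Rightarrow> 'a" where
  "translation X qop x = (\<lambda>y\<in>X. qop y x)"

definition Inn :: "'a set \<Rightarrow> ('a \<Rightarrow> 'a \<Rightarrow> 'a) \<Rightarrow> ('a \<Rightarrow> 'a) monoid" where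
  "Inn X qop = subgroup_generated (BijGroup X) (translation X qop ` X)"

definition abelian_quandle :: "'a set \<Rightarrow> ('a \<Rightarrow> 'a \<Rightarrow> 'a) \<Rightarrow> bool" where
  "abelian_quandle X qop \<longleftrightarrow> quandle X qop \<and> comm_group (Inn X qop)"

definition subquandle :: "'a set \<Rightarrow> ('a \<Rightarrow> 'a \<Rightarrow> 'a) \<Rightarrow> 'a set \<Rightarrow> bool" where
  "subquandle X qop T \<longleftrightarrow>
     T \<subseteq> X \<and> (\<forall>x\<in>T. \<forall>y\<in>T. qop x y \<in> T \<and> qinv X qop x y \<in> T)"

definition generated_subquandle :: "'a set \<Rightarrow> ('a \<Rightarrow> 'a \<Rightarrow> 'a) \<Rightarrow> 'a set \<Rightarrow> 'a set" where
  "generated_subquandle X qop G = \<Inter>{T. subquandle X qop T \<and> G \<subseteq> T}"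

definition fin_gen_subquandle :: "'a set \<Rightarrow> ('a \<Rightarrow> 'a \<Rightarrow> 'a) \<Rightarrow> 'a set \<Rightarrow> bool" where
  "fin_gen_subquandle X qop T \<longleftrightarrow>
     (\<exists>G. finite G \<and> G \<subseteq> X \<and> T = generated_subquandle X qop G)"

definition quandle_hom ::
    "'a set \<Rightarrow> ('a \<Rightarrow> 'a \<Rightarrow> 'a) \<Rightarrow> 'b set \<Rightarrow> ('b \<Rightarrow> 'b \<Rightarrow> 'b) \<Rightarrow> ('a \<Rightarrow> 'b) \<Rightarrow> bool" where
  "quandle_hom X qop F qop' \<phi> \<longleftrightarrow>
     \<phi> \<in> X \<rightarrow> F \<and> (\<forall>x\<in>X. \<forall>y\<in>X. \<phi> (qop x y) = qop' (\<phi> x) (\<phi> y))"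

text \<open>Existential quantification over types being impossible, the finite quandle is taken with a
  carrier in \<^typ>\<open>nat\<close>; every finite quandle is isomorphic to such a one, and
  \<open>separableI\<close> below shows that nothing is lost.\<close>

definition separable :: "'a set \<Rightarrow> ('a \<Rightarrow> 'a \<Rightarrow> 'a) \<Rightarrow> 'a set \<Rightarrow> bool" where
  "separable X qop S \<longleftrightarrow>
     (\<forall>x\<in>X - S. \<exists>(F :: nat set) qop' \<phi>.
        finite F \<and> quandle F qop' \<and> quandle_hom X qop F qop' \<phi> \<and> \<phi> x \<notin> \<phi> ` S)"

definition subquandle_separable :: "'a set \<Rightarrow> ('a \<Rightarrow> 'a \<Rightarrow> 'a) \<Rightarrow> bool" where
  "subquandle_separable X qop \<longleftrightarrow>
     (\<forall>T. fin_gen_subquandle X qop T \<longrightarrow> separable X qop T)"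


lemma (in quandle) qinv_closed:
  assumes "x \<in> X" "y \<in> X"
  shows "qinv X qop x y \<in> X" "qinv X qop x y \<triangleleft> y = x"
proof -
  have "qinv X qop x y \<in> X \<and> x = qinv X qop x y \<triangleleft> y"
    unfolding qinv_def by (rule theI'[OF ex1_divisor[OF assms]])
  then show "qinv X qop x y \<in> X" "qinv X qop x y \<triangleleft> y = x" by simp_all
qed

lemma (in quandle) subquandle_generated:
  assumes "G \<subseteq> X"
  shows "subquandle X qop (generated_subquandle X qop G)"
proof -
  have X: "subquandle X qop X"
    by (simp add: subquandle_def closed qinv_closed)
  show ?thesis
    unfolding subquandle_def[of _ _ "generated_subquandle X qop G"]
  proof (intro conjI ballI)
    show "generated_subquandle X qop G \<subseteq> X"
      unfolding generated_subquandle_def using X assms by blast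
  qed (auto simp: generated_subquandle_def subquandle_def)
qed

lemma (in quandle) translation_Bij:
  assumes "x \<in> X"
  shows "translation X qop x \<in> Bij X"
proof -
  have "inj_on (\<lambda>y. y \<triangleleft> x) X"
    by (rule inj_onI) (use closed[OF _ assms] ex1_divisor[OF _ assms] in blast)
  moreover have "(\<lambda>y. y \<triangleleft> x) ` X = X"
  proof
    show "X \<subseteq> (\<lambda>y. y \<triangleleft> x) ` X"
      using qinv_closed[OF _ assms] by (intro subsetI) (metis image_eqI)
  qed (use closed[OF _ assms] in blast)
  ultimately show ?thesis
    by (simp add: Bij_def translation_def bij_betw_def inj_on_restrict_eq)
qed

lemma (in group) comm_group_subgroup_generated:
  assumes "A \<subseteq> carrier G" and comm: "\<And>a b. a \<in> A \<Longrightarrow> b \<in> A \<Longrightarrow> a \<otimes> b = b \<otimes> a"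
  shows "comm_group (subgroup_generated G A)"
proof -
  have inC: "g \<in> carrier G" if "g \<in> generate G A" for g
    using generate_in_carrier[OF assms(1) that] .
  have invc: "inv h \<otimes> k = k \<otimes> inv h"
    if "h \<in> carrier G" "k \<in> carrier G" "h \<otimes> k = k \<otimes> h" for h k
    using that by (metis inv_closed inv_solve_left inv_solve_right m_assoc m_closed)
  have 1: "g \<otimes> a = a \<otimes> g" if "g \<in> generate G A" "a \<in> A" for g a
    using that(1)
  proof (induction rule: generate.induct)
    case one then show ?case using assms(1) that(2) by auto
  next
    case (incl h) then show ?case using comm that(2) by blast
  next
    case (inv h) then show ?case using comm[of h a] invc[of h a] that(2) assms(1) by auto
  next
    case (eng h k)
    then show ?case using inC[of h] inC[of k] assms(1) that(2) by (metis m_assoc subsetD)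
  qed
  have 2: "g \<otimes> h = h \<otimes> g" if "g \<in> generate G A" "h \<in> generate G A" for g h
    using that(2)
  proof (induction rule: generate.induct)
    case one then show ?case using inC[OF that(1)] by auto
  next
    case (incl h) then show ?case using 1 that(1) by blast
  next
    case (inv h) then show ?case using 1[OF that(1) inv] invc[of h g] inC[OF that(1)] assms(1) by auto
  next
    case (eng h k)
    then show ?case using inC[of h] inC[of k] inC[OF that(1)] by (metis m_assoc)
  qed
  have "carrier (subgroup_generated G A) = generate G A"
    using assms(1) by (simp add: carrier_subgroup_generated Int_absorb1)
  then show ?thesis
    using 2 by (intro group.group_comm_groupI) auto
qed

lemma (in quandle) abelian_quandle_iff:
  "abelian_quandle X qop \<longleftrightarrow> (\<forall>x\<in>X. \<forall>y\<in>X. \<forall>z\<in>X. (x \<triangleleft> y) \<triangleleft> z = (x \<triangleleft> z) \<triangleleft> y)"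
proof -
  interpret B: group "BijGroup X" by (rule group_BijGroup)
  let ?t = "translation X qop"
  have t: "?t ` X \<subseteq> carrier (BijGroup X)"
    using translation_Bij by (auto simp: BijGroup_def)
  have mult: "?t z \<otimes>\<^bsub>BijGroup X\<^esub> ?t y = (\<lambda>x\<in>X. (x \<triangleleft> y) \<triangleleft> z)" if "y \<in> X" "z \<in> X" for y z
    using that closed translation_Bij
    by (auto simp: BijGroup_def compose_def translation_def restrict_def)
  have fn: "(?t z \<otimes>\<^bsub>BijGroup X\<^esub> ?t y = ?t y \<otimes>\<^bsub>BijGroup X\<^esub> ?t z) \<longleftrightarrow>
      (\<forall>x\<in>X. (x \<triangleleft> y) \<triangleleft> z = (x \<triangleleft> z) \<triangleleft> y)" if "y \<in> X" "z \<in> X" for y z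
    unfolding mult[OF that] mult[OF that(2,1)] by (auto simp: restrict_def fun_eq_iff)
  have "comm_group (Inn X qop) \<longleftrightarrow>
      (\<forall>y\<in>X. \<forall>z\<in>X. ?t z \<otimes>\<^bsub>BijGroup X\<^esub> ?t y = ?t y \<otimes>\<^bsub>BijGroup X\<^esub> ?t z)" (is "_ \<longleftrightarrow> ?R")
  proof
    assume "comm_group (Inn X qop)"
    then interpret I: comm_group "Inn X qop" .
    have "?t x \<in> carrier (Inn X qop)" if "x \<in> X" for x
      using that t by (auto simp: Inn_def carrier_subgroup_generated intro!: generate.incl)
    then show ?R using I.m_comm by (simp add: Inn_def)
  next
    assume ?R
    then show "comm_group (Inn X qop)"
      unfolding Inn_def using t by (intro B.comm_group_subgroup_generated) auto
  qed
  also have "\<dots> \<longleftrightarrow> (\<forall>y\<in>X. \<forall>z\<in>X. \<forall>x\<in>X. (x \<triangleleft> y) \<triangleleft> z = (x \<triangleleft> z) \<triangleleft> y)"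
    using fn by simp
  also have "\<dots> \<longleftrightarrow> (\<forall>x\<in>X. \<forall>y\<in>X. \<forall>z\<in>X. (x \<triangleleft> y) \<triangleleft> z = (x \<triangleleft> z) \<triangleleft> y)"
    by blast
  finally show ?thesis
    using quandle_axioms by (simp only: abelian_quandle_def simp_thms)
qed

lemma quandle_transport:
  assumes "quandle F qop" and "inj_on f F"
  defines "g \<equiv> inv_into F f"
  shows "quandle (f ` F) (\<lambda>x y. f (qop (g x) (g y)))"
proof -
  interpret quandle F qop by fact
  have gf: "g (f x) = x" if "x \<in> F" for x
    using that assms(2) by (simp add: g_def)
  show ?thesis
  proof
    fix x y assume "x \<in> f ` F" "y \<in> f ` F"
    then obtain a b where ab: "a \<in> F" "b \<in> F" "x = f a" "y = f b" by auto
    obtain c where c: "c \<in> F" "a = qop c b" "\<And>d. d \<in> F \<Longrightarrow> a = qop d b \<Longrightarrow> d = c"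
      using ex1_divisor[OF ab(1,2)] by blast
    show "\<exists>!z. z \<in> f ` F \<and> x = f (qop (g z) (g y))"
    proof (rule ex1I[of _ "f c"])
      show "f c \<in> f ` F \<and> x = f (qop (g (f c)) (g y))" using ab(2-4) c(1,2) by (simp add: gf)
      fix z assume "z \<in> f ` F \<and> x = f (qop (g z) (g y))"
      then obtain d where d: "d \<in> F" "z = f d" "f a = f (qop d b)" using ab gf by auto
      then have "a = qop d b" using assms(2) ab closed by (metis inj_onD)
      then show "z = f c" using c(3) d by blast
    qed
  next
    fix x y z assume "x \<in> f ` F" "y \<in> f ` F" "z \<in> f ` F"
    then obtain a b c where "a \<in> F" "b \<in> F" "c \<in> F" "x = f a" "y = f b" "z = f c" by auto
    then show "f (qop (g (f (qop (g x) (g y)))) (g z)) =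
        f (qop (g (f (qop (g x) (g z)))) (g (f (qop (g y) (g z)))))"
      using self_distrib[of a b c] by (simp add: gf closed)
  qed (auto simp: gf closed idem)
qed

lemma separableI:
  assumes "\<And>x. x \<in> X - S \<Longrightarrow> \<exists>(F :: 'b set) qop' \<phi>.
      finite F \<and> quandle F qop' \<and> quandle_hom X qop F qop' \<phi> \<and> \<phi> x \<notin> \<phi> ` S"
    and "S \<subseteq> X"
  shows "separable X qop S"
  unfolding separable_def
proof
  fix x assume x: "x \<in> X - S"
  obtain F :: "'b set" and qop' \<phi> where F: "finite F" "quandle F qop'"
    "quandle_hom X qop F qop' \<phi>" "\<phi> x \<notin> \<phi> ` S"
    using assms(1)[OF x] by blast
  obtain f :: "'b \<Rightarrow> nat" where f: "inj_on f F"
    using finite_imp_inj_to_nat_seg[OF F(1)] by blast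
  let ?g = "inv_into F f"
  have \<phi>: "\<phi> y \<in> F" if "y \<in> X" for y using F(3) that by (auto simp: quandle_hom_def)
  have "quandle_hom X qop (f ` F) (\<lambda>x y. f (qop' (?g x) (?g y))) (f \<circ> \<phi>)"
    using F(3) f \<phi> by (auto simp: quandle_hom_def)
  moreover have "(f \<circ> \<phi>) x \<notin> (f \<circ> \<phi>) ` S"
  proof
    assume "(f \<circ> \<phi>) x \<in> (f \<circ> \<phi>) ` S"
    then obtain s where "s \<in> S" "f (\<phi> x) = f (\<phi> s)" by auto
    then have "\<phi> x = \<phi> s" using f \<phi> x assms(2) by (meson DiffD1 inj_onD subsetD)
    then show False using F(4) \<open>s \<in> S\<close> by blast
  qed
  ultimately show "\<exists>(F :: nat set) qop' \<phi>.
      finite F \<and> quandle F qop' \<and> quandle_hom X qop F qop' \<phi> \<and> \<phi> x \<notin> \<phi> ` S"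
    using quandle_transport[OF F(2) f] F(1) by blast
qed

end

theory Submission
  imports Defs
begin

text \<open>Exchanging translations, \<open>(x * y) * z = (x * z) * y\<close>, makes the translation by an element
  depend only on the orbit of that element: write \<open>z = w * y\<close>; then
  \<open>z * (x * y) = (w * x) * y = z * x\<close>. If \<open>a\<close> and \<open>b\<close> generate \<open>X\<close>, there are thus only two
  translations, \<open>S\<^sub>a\<close> and \<open>S\<^sub>b\<close>. They commute and \<open>S\<^sub>a\<close> fixes \<open>a\<close>, so \<open>S\<^sub>a\<close> fixes every
  \<open>\<sigma> k = S\<^sub>b\<^sup>k a\<close>; likewise \<open>S\<^sub>b\<close> fixes every \<open>\<tau> k = S\<^sub>a\<^sup>k b\<close>. Hence \<open>X\<close> is the union of the
  two cyclic orbits \<open>\<sigma>\<close> and \<open>\<tau>\<close>, each of them a trivial quandle, and an element of one orbit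
  shifts the other orbit by one step (\<open>walk_step\<close>, \<open>walk_fixed\<close>, \<open>carrier_eq\<close>).

  There are then few subquandles. One that meets both orbits is closed under both shifts and is all
  of \<open>X\<close>, while one inside a single orbit is an arbitrary subset, so it is finite when
  finitely generated (\<open>generated_cases\<close>). The whole of \<open>X\<close> is separable for trivial reasons. For a
  finite subset \<open>T\<close> of the orbit \<open>\<sigma>\<close> and a point \<open>x\<close> outside it, collapse the other orbit to one
  point and reduce the index \<open>k\<close> of \<open>\<sigma> k\<close> modulo some \<open>N\<close>; the result is a finite
  quandle (\<open>hub_quandle\<close>), and \<open>N\<close> can be chosen so that \<open>x\<close> stays apart from \<open>T\<close>
  because a cyclic orbit is either a finite cycle or a copy of the integers
  (\<open>cyclic_walk_separation\<close>). Collapsing one orbit and not the other makes sense only for disjoint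
  orbits; if they meet, \<open>X\<close> is a single point (\<open>walks_meet_imp_singleton\<close>).\<close>

section \<open>Cyclic walks modulo an integer\<close>

text \<open>A walk driven by a bijection is either injective or periodic. In the periodic case the least
  period serves as modulus; in the injective case any modulus exceeding the finitely many relevant
  index differences does.\<close>

lemma cyclic_walk_separation:
  fixes \<sigma> :: "int \<Rightarrow> 'a"
  assumes shift: "\<And>i j k. \<sigma> i = \<sigma> j \<Longrightarrow> \<sigma> (i + k) = \<sigma> (j + k)"
    and fin: "finite T" and x: "x \<notin> T"
  obtains N :: int where "N > 0" "\<And>i j. \<sigma> i = \<sigma> j \<Longrightarrow> N dvd i - j"
    "\<And>i j. \<sigma> i = x \<Longrightarrow> \<sigma> j \<in> T \<Longrightarrow> \<not> N dvd i - j"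
proof (cases "inj \<sigma>")
  case True
  define J where "J = \<sigma> -` T"
  have J: "finite J" unfolding J_def using fin True by (rule finite_vimageI)
  show ?thesis
  proof (cases "x \<in> range \<sigma>")
    case False
    then show ?thesis using that[of 1] True by (auto dest: injD)
  next
    case x_in: True
    then obtain i where i: "x = \<sigma> i" by auto
    let ?N = "1 + (\<Sum>j\<in>J. \<bar>i - j\<bar>)"
    have small: "\<bar>i - j\<bar> < ?N" if "j \<in> J" for j
      using member_le_sum[of j J "\<lambda>j. \<bar>i - j\<bar>"] J that by simp
    have "\<not> ?N dvd i' - j" if "\<sigma> i' = x" "\<sigma> j \<in> T" for i' j
    proof
      assume dvd: "?N dvd i' - j"
      have "i' = i" using that(1) i True by (simp add: inj_eq)
      moreover have "j \<in> J" using that(2) by (simp add: J_def)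
      ultimately have "i' - j = 0"
        using small[of j] dvd dvd_imp_le_int[of "i' - j" ?N] by fastforce
      then show False using that x by simp
    qed
    moreover have "?N > 0" by (simp add: add_pos_nonneg sum_nonneg)
    ultimately show ?thesis using that[of ?N] True by (auto simp: inj_eq)
  qed
next
  case False
  then obtain i j where ij: "\<sigma> i = \<sigma> j" "i < j"
    unfolding inj_def by (metis linorder_neqE)
  let ?P = "\<lambda>n. n > 0 \<and> \<sigma> (int n) = \<sigma> 0"
  define N where "N = int (LEAST n. ?P n)"
  have "?P (nat (j - i))" using shift[OF ij(1), of "- i"] ij(2) by simp
  then have least: "?P (nat N)" unfolding N_def nat_int by (rule LeastI)
  then have N: "N > 0" "\<sigma> N = \<sigma> 0" by auto
  have minimal: "r = 0" if "0 \<le> r" "r < N" "\<sigma> r = \<sigma> 0" for r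
  proof (rule ccontr)
    assume "r \<noteq> 0"
    then have "?P (nat r)" using that by simp
    then have "(LEAST n. ?P n) \<le> nat r" by (rule Least_le)
    then show False using that(1,2) by (simp add: N_def)
  qed
  have up: "\<sigma> (k + N) = \<sigma> k" for k using shift[OF N(2), of k] by (simp add: add.commute)
  have mult: "\<sigma> (k + N * m) = \<sigma> k" for k m
  proof (induction m rule: int_induct[where k = 0])
    case (step1 m) then show ?case using up[of "k + N * m"] by (simp add: algebra_simps)
  next
    case (step2 m) then show ?case using up[of "k + N * (m - 1)"] by (simp add: algebra_simps)
  qed simp
  have eq_if_dvd: "\<sigma> i = \<sigma> j" if dvd: "N dvd i - j" for i j
  proof -
    obtain m where "i - j = N * m" using dvd by (rule dvdE)
    then have "i = j + N * m" by simp
    then show ?thesis by (simp only: mult)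
  qed
  have "N dvd i - j" if "\<sigma> i = \<sigma> j" for i j
  proof -
    have "\<sigma> ((i - j) mod N) = \<sigma> (i - j)"
      by (rule eq_if_dvd) (simp add: mod_eq_dvd_iff [symmetric])
    also have "\<dots> = \<sigma> 0" using shift[OF that, of "- j"] by simp
    finally have "(i - j) mod N = 0" using minimal N(1) by simp
    then show ?thesis by (rule mod_0_imp_dvd)
  qed
  then show ?thesis using that[of N] N(1) eq_if_dvd x by metis
qed


section \<open>Finite quotients: a cycle with a hub\<close>

text \<open>\<open>None\<close> is the hub, whose translation rotates the cycle of residues; every other
  translation is the identity.\<close>

fun hub_op :: "int \<Rightarrow> int option \<Rightarrow> int option \<Rightarrow> int option" where
  "hub_op N (Some u) None = Some ((u + 1) mod N)"
| "hub_op N u v = u"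

definition hub_carrier :: "int \<Rightarrow> int option set" where
  "hub_carrier N = insert None (Some ` {0..<N})"

lemma finite_hub_carrier: "finite (hub_carrier N)"
  by (simp add: hub_carrier_def)

lemma hub_quandle:
  assumes "N > 0"
  shows "quandle (hub_carrier N) (hub_op N)"
proof
  fix x y assume x: "x \<in> hub_carrier N" and y: "y \<in> hub_carrier N"
  show "\<exists>!z. z \<in> hub_carrier N \<and> x = hub_op N z y"
  proof (cases y)
    case (Some v)
    then have "hub_op N z y = z" for z by (cases z) auto
    then show ?thesis using x by auto
  next
    case y: None
    show ?thesis
    proof (cases x)
      case None
      have "z = None" if "None = hub_op N z None" for z using that by (cases z) auto
      then show ?thesis using None y by (intro ex1I[of _ None]) (auto simp: hub_carrier_def)
    next
      case (Some u)
      then have u: "0 \<le> u" "u < N" using x by (auto simp: hub_carrier_def)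
      show ?thesis
      proof (rule ex1I[of _ "Some ((u - 1) mod N)"])
        show "Some ((u - 1) mod N) \<in> hub_carrier N \<and> x = hub_op N (Some ((u - 1) mod N)) y"
          using assms u by (simp add: hub_carrier_def Some y mod_simps)
        fix z assume z: "z \<in> hub_carrier N \<and> x = hub_op N z y"
        then obtain w where w: "z = Some w" "u = (w + 1) mod N"
          using Some y by (cases z) auto
        have "0 \<le> w" "w < N" using z w(1) by (auto simp: hub_carrier_def)
        then show "z = Some ((u - 1) mod N)" by (simp add: w mod_simps)
      qed
    qed
  qed
next
  fix x y assume "x \<in> hub_carrier N" "y \<in> hub_carrier N"
  then show "hub_op N x y \<in> hub_carrier N"
    using assms by (cases x; cases y) (auto simp: hub_carrier_def)
next
  fix x show "hub_op N x x = x" by (cases x) auto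
next
  fix x y z show "hub_op N (hub_op N x y) z = hub_op N (hub_op N x z) (hub_op N y z)"
    by (cases x; cases y; cases z) auto
qed


section \<open>Generated subquandles and separability\<close>

lemma generated_subquandle_least:
  "subquandle X qop T \<Longrightarrow> G \<subseteq> T \<Longrightarrow> generated_subquandle X qop G \<subseteq> T"
  unfolding generated_subquandle_def by blast

lemma generators_subset: "G \<subseteq> generated_subquandle X qop G"
  unfolding generated_subquandle_def by blast

lemma separable_carrier: "separable X qop X"
  by (simp add: separable_def)

lemma separable_empty: "separable X qop {}"
proof (rule separableI)
  fix x
  have "quandle {()} (\<lambda>_ _. ())" by unfold_locales auto
  then show "\<exists>(F :: unit set) qop' \<phi>. finite F \<and> quandle F qop' \<and>
      quandle_hom X qop F qop' \<phi> \<and> \<phi> x \<notin> \<phi> ` {}"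
    by (intro exI[of _ "{()}"] exI[of _ "\<lambda>_ _. ()"] exI[of _ "\<lambda>_. ()"])
      (auto simp: quandle_hom_def)
qed simp

context quandle
begin

lemma right_cancel:
  assumes "x \<in> X" "y \<in> X" "z \<in> X" "x \<triangleleft> z = y \<triangleleft> z"
  shows "x = y"
  using assms ex1_divisor[OF closed[OF assms(1,3)] assms(3)] by blast

lemma qinv_eqI:
  assumes "z \<in> X" "y \<in> X" "z \<triangleleft> y = x"
  shows "qinv X qop x y = z"
  using assms qinv_closed[of x y] closed right_cancel by metis

text \<open>Negative indices iterate the inverse translation.\<close>

lemma translation_walk:
  assumes "a \<in> X" "b \<in> X"
  obtains \<sigma> :: "int \<Rightarrow> 'a"
  where "\<sigma> 0 = a" "\<And>k. \<sigma> k \<in> X" "\<And>k. \<sigma> (k + 1) = \<sigma> k \<triangleleft> b"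
proof -
  define u where "u n = ((\<lambda>y. y \<triangleleft> b) ^^ n) a" for n
  define v where "v n = ((\<lambda>y. qinv X qop y b) ^^ n) a" for n
  define \<sigma> where "\<sigma> k = (if k \<ge> 0 then u (nat k) else v (nat (- k)))" for k
  have uX: "u n \<in> X" for n unfolding u_def by (induction n) (auto simp: assms closed)
  have vX: "v n \<in> X" for n unfolding v_def by (induction n) (auto simp: assms qinv_closed)
  have v_Suc: "v (Suc n) \<triangleleft> b = v n" for n
    using qinv_closed(2)[OF vX assms(2)] by (simp add: v_def)
  have "\<sigma> (k + 1) = \<sigma> k \<triangleleft> b" for k
  proof (cases "k \<ge> 0")
    case True
    then have "nat (k + 1) = Suc (nat k)" by simp
    then show ?thesis using True by (simp add: \<sigma>_def u_def)
  next
    case False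
    then have "nat (- k) = Suc (nat (- (k + 1)))" by simp
    then have "\<sigma> k \<triangleleft> b = v (nat (- (k + 1)))" using False v_Suc by (simp add: \<sigma>_def)
    \<comment> \<open>The two branches of \<open>\<sigma>\<close> meet at index \<open>0\<close>, where \<open>u\<close> and \<open>v\<close> both start at \<open>a\<close>.\<close>
    also have "\<dots> = \<sigma> (k + 1)" using False by (auto simp: \<sigma>_def u_def v_def)
    finally show ?thesis by simp
  qed
  moreover have "\<sigma> 0 = a" by (simp add: \<sigma>_def u_def)
  ultimately show ?thesis using that[of \<sigma>] uX vX by (simp add: \<sigma>_def)
qed

end


section \<open>Abelian quandles with two generators\<close>

text \<open>The generators are \<open>\<sigma> 0\<close> and \<open>\<tau> 0\<close>. Carrying the two walks as parameters keeps the
  situation symmetric, so that every fact about \<open>\<sigma>\<close> is also available for \<open>\<tau>\<close>.\<close>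

locale two_walks = quandle X qop for X :: "'a set" and qop (infixl "\<triangleleft>" 70) +
  fixes \<sigma> \<tau> :: "int \<Rightarrow> 'a"
  assumes exchange: "x \<in> X \<Longrightarrow> y \<in> X \<Longrightarrow> z \<in> X \<Longrightarrow> (x \<triangleleft> y) \<triangleleft> z = (x \<triangleleft> z) \<triangleleft> y"
    and walk_in: "\<sigma> k \<in> X" "\<tau> k \<in> X"
    and walk_Suc: "\<sigma> (k + 1) = \<sigma> k \<triangleleft> \<tau> 0" "\<tau> (k + 1) = \<tau> k \<triangleleft> \<sigma> 0"
    and generated: "generated_subquandle X qop {\<sigma> 0, \<tau> 0} = X"
begin

lemma swap: "two_walks X qop \<tau> \<sigma>"
  using exchange walk_in walk_Suc generated by unfold_locales (auto simp: insert_commute)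

text \<open>Write \<open>z = w * y\<close> and combine self-distributivity with exchange.\<close>

lemma translation_orbit_invariant:
  assumes "x \<in> X" "y \<in> X" "z \<in> X"
  shows "z \<triangleleft> (x \<triangleleft> y) = z \<triangleleft> x"
proof -
  obtain w where w: "w \<in> X" "z = w \<triangleleft> y" using ex1_divisor[OF assms(3,2)] by blast
  then have "z \<triangleleft> (x \<triangleleft> y) = (w \<triangleleft> x) \<triangleleft> y" using self_distrib[of w x y] assms by simp
  then show ?thesis using w exchange[of w x y] assms by simp
qed

lemma translation_walk_eq:
  assumes "z \<in> X"
  shows "z \<triangleleft> \<sigma> k = z \<triangleleft> \<sigma> 0"
proof (induction k rule: int_induct[where k = 0])
  case (step1 k)
  then show ?case using translation_orbit_invariant[of "\<sigma> k" "\<tau> 0" z] assms walk_in walk_Suc by simp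
next
  case (step2 k)
  then show ?case
    using translation_orbit_invariant[of "\<sigma> (k - 1)" "\<tau> 0" z] assms walk_in walk_Suc(1)[of "k - 1"]
    by simp
qed simp

text \<open>\<open>S\<^sub>a\<close> fixes \<open>a\<close> and commutes with \<open>S\<^sub>b\<close>, so it fixes the whole orbit of \<open>a\<close> under \<open>S\<^sub>b\<close>.\<close>

lemma walk_fixed: "\<sigma> k \<triangleleft> \<sigma> j = \<sigma> k"
proof -
  have "\<sigma> k \<triangleleft> \<sigma> 0 = \<sigma> k"
  proof (induction k rule: int_induct[where k = 0])
    case base then show ?case by (simp add: idem walk_in)
  next
    case (step1 k)
    then show ?case using exchange[of "\<sigma> k" "\<tau> 0" "\<sigma> 0"] walk_in walk_Suc by simp
  next
    case (step2 k)
    have "(\<sigma> (k - 1) \<triangleleft> \<sigma> 0) \<triangleleft> \<tau> 0 = \<sigma> (k - 1) \<triangleleft> \<tau> 0"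
      using step2 exchange[of "\<sigma> (k - 1)" "\<tau> 0" "\<sigma> 0"] walk_in walk_Suc(1)[of "k - 1"] by simp
    then show ?case using right_cancel closed walk_in by blast
  qed
  then show ?thesis using translation_walk_eq[of "\<sigma> k" j] walk_in by simp
qed

lemma walk_step: "\<sigma> k \<triangleleft> \<tau> j = \<sigma> (k + 1)"
  using two_walks.translation_walk_eq[OF swap, of "\<sigma> k" j] walk_in walk_Suc by simp

lemma qinv_walk: "qinv X qop (\<sigma> k) (\<sigma> j) = \<sigma> k" "qinv X qop (\<sigma> k) (\<tau> j) = \<sigma> (k - 1)"
  using walk_in walk_fixed walk_step[of "k - 1"] by (auto intro!: qinv_eqI)

lemma carrier_eq: "X = range \<sigma> \<union> range \<tau>"
proof
  have "subquandle X qop (range \<sigma> \<union> range \<tau>)"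
    unfolding subquandle_def
    using walk_in walk_fixed walk_step qinv_walk two_walks.walk_fixed[OF swap]
      two_walks.walk_step[OF swap] two_walks.qinv_walk[OF swap]
    by auto
  then show "X \<subseteq> range \<sigma> \<union> range \<tau>"
    using generated_subquandle_least[of X qop "range \<sigma> \<union> range \<tau>" "{\<sigma> 0, \<tau> 0}"] generated by auto
qed (use walk_in in auto)

lemma walk_shift: "\<sigma> i = \<sigma> j \<Longrightarrow> \<sigma> (i + k) = \<sigma> (j + k)"
proof (induction k rule: int_induct[where k = 0])
  case (step1 k)
  then show ?case using walk_Suc(1)[of "i + k"] walk_Suc(1)[of "j + k"] by (simp add: add.assoc)
next
  case (step2 k)
  then have "\<sigma> (i + (k - 1)) \<triangleleft> \<tau> 0 = \<sigma> (j + (k - 1)) \<triangleleft> \<tau> 0"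
    using walk_Suc(1)[of "i + (k - 1)"] walk_Suc(1)[of "j + (k - 1)"] by simp
  then show ?case using right_cancel walk_in by blast
qed simp

text \<open>A common point forces the two translations to agree, and then each generator is fixed by
  both of them.\<close>

lemma walks_meet_imp_singleton:
  assumes "\<sigma> i = \<tau> j"
  shows "X = {\<sigma> 0}"
proof -
  have \<sigma>: "\<sigma> (k + 1) = \<sigma> k" for k using walk_fixed[of k i] walk_step[of k j] assms by simp
  have \<tau>: "\<tau> (k + 1) = \<tau> k" for k
    using two_walks.walk_fixed[OF swap, of k j] two_walks.walk_step[OF swap, of k i] assms by simp
  have const: "f k = f 0" if "\<And>k. f (k + 1) = f k" for f :: "int \<Rightarrow> 'a" and k
  proof (induction k rule: int_induct[where k = 0])
    case (step2 k)
    then show ?case using that[of "k - 1"] by simp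
  qed (simp_all add: that)
  have "\<sigma> k = \<sigma> 0" "\<tau> k = \<tau> 0" for k using const[of \<sigma>] const[of \<tau>] \<sigma> \<tau> by blast+
  then have "\<sigma> k = \<sigma> 0" "\<tau> k = \<sigma> 0" for k using assms by metis+
  then show ?thesis using carrier_eq by auto
qed

lemma subset_walk_subquandle:
  assumes "T \<subseteq> range \<sigma>"
  shows "subquandle X qop T"
proof -
  have "x \<triangleleft> y = x \<and> qinv X qop x y = x" if "x \<in> T" "y \<in> T" for x y
    using that assms walk_fixed qinv_walk(1) by blast
  then show ?thesis using assms walk_in by (auto simp: subquandle_def)
qed

text \<open>Each of the two points lets the subquandle move along the whole of the other walk.\<close>

lemma subquandle_meets_both:
  assumes T: "subquandle X qop T" and i: "\<sigma> i \<in> T" and j: "\<tau> j \<in> T"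
  shows "range \<sigma> \<subseteq> T"
proof -
  have "\<sigma> (i + k) \<in> T" for k
  proof (induction k rule: int_induct[where k = 0])
    case (step1 k)
    then have "\<sigma> (i + k) \<triangleleft> \<tau> j \<in> T" using T j by (auto simp: subquandle_def)
    then show ?case by (simp add: walk_step add.assoc)
  next
    case (step2 k)
    then have "qinv X qop (\<sigma> (i + k)) (\<tau> j) \<in> T" using T j by (auto simp: subquandle_def)
    then show ?case by (simp add: qinv_walk algebra_simps)
  qed (simp add: i)
  then have "\<sigma> (i + (k - i)) \<in> T" for k .
  then show ?thesis by auto
qed

lemma generated_cases:
  assumes "G \<subseteq> X"
  obtains "generated_subquandle X qop G = X"
    | "generated_subquandle X qop G = G" "G \<subseteq> range \<sigma> \<or> G \<subseteq> range \<tau>"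
proof (cases "G \<subseteq> range \<sigma> \<or> G \<subseteq> range \<tau>")
  case True
  then have "subquandle X qop G"
    using subset_walk_subquandle two_walks.subset_walk_subquandle[OF swap] by blast
  then have "generated_subquandle X qop G = G"
    using generated_subquandle_least generators_subset by (metis order_refl subset_antisym)
  then show ?thesis using that True by blast
next
  case False
  let ?T = "generated_subquandle X qop G"
  obtain i j where "\<sigma> i \<in> G" "\<tau> j \<in> G" using False assms carrier_eq by blast
  then have "\<sigma> i \<in> ?T" "\<tau> j \<in> ?T" using generators_subset[of G X qop] by auto
  then have "range \<sigma> \<subseteq> ?T" "range \<tau> \<subseteq> ?T"
    using subquandle_meets_both[of ?T i j] two_walks.subquandle_meets_both[OF swap, of ?T j i]
      subquandle_generated[OF assms] by auto
  then have "?T = X"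
    using subquandle_generated[OF assms] carrier_eq unfolding subquandle_def by blast
  then show ?thesis using that by blast
qed

text \<open>Collapsing the walk \<open>\<tau>\<close> to the hub already separates its points from \<open>T\<close>; the modulus takes
  care of the points of \<open>\<sigma>\<close>.\<close>

lemma finite_subset_walk_separable:
  assumes disj: "range \<sigma> \<inter> range \<tau> = {}" and T: "finite T" "T \<subseteq> range \<sigma>"
  shows "separable X qop T"
proof (rule separableI)
  show "T \<subseteq> X" using T walk_in by auto
next
  fix x assume x: "x \<in> X - T"
  obtain N :: int where N: "N > 0" "\<And>i j. \<sigma> i = \<sigma> j \<Longrightarrow> N dvd i - j"
    "\<And>i j. \<sigma> i = x \<Longrightarrow> \<sigma> j \<in> T \<Longrightarrow> \<not> N dvd i - j"
    using cyclic_walk_separation[of \<sigma> T x] walk_shift T(1) x by blast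
  \<comment> \<open>An index of \<open>y\<close> is determined only up to periods of \<open>\<sigma>\<close>, all of which \<open>N\<close> divides.\<close>
  define \<phi> where "\<phi> y = (if y \<in> range \<sigma> then Some ((SOME k. \<sigma> k = y) mod N) else None)" for y
  have \<phi>\<sigma>: "\<phi> (\<sigma> k) = Some (k mod N)" for k
  proof -
    have "\<sigma> (SOME i. \<sigma> i = \<sigma> k) = \<sigma> k" by (rule someI[of _ k]) simp
    then show ?thesis using N(2) by (simp add: \<phi>_def mod_eq_dvd_iff)
  qed
  have \<phi>\<tau>: "\<phi> (\<tau> k) = None" for k using disj by (auto simp: \<phi>_def)
  have "quandle_hom X qop (hub_carrier N) (hub_op N) \<phi>"
    unfolding quandle_hom_def
  proof (intro conjI ballI)
    show "\<phi> \<in> X \<rightarrow> hub_carrier N"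
      using N(1) carrier_eq by (auto simp: \<phi>\<sigma> \<phi>\<tau> hub_carrier_def)
  next
    fix y z assume "y \<in> X" "z \<in> X"
    then show "\<phi> (y \<triangleleft> z) = hub_op N (\<phi> y) (\<phi> z)"
      unfolding carrier_eq
      by (auto simp: \<phi>\<sigma> \<phi>\<tau> walk_fixed walk_step two_walks.walk_fixed[OF swap]
          two_walks.walk_step[OF swap] mod_simps)
  qed
  moreover have "\<phi> x \<notin> \<phi> ` T"
  proof
    assume "\<phi> x \<in> \<phi> ` T"
    then obtain j where j: "\<sigma> j \<in> T" "\<phi> x = Some (j mod N)" using T(2) \<phi>\<sigma> by auto
    then obtain i where "x = \<sigma> i" using x carrier_eq \<phi>\<tau> by auto
    then show False using N(3)[of i j] j \<phi>\<sigma> by (simp add: mod_eq_dvd_iff)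
  qed
  ultimately show "\<exists>(F :: int option set) qop' \<phi>. finite F \<and> quandle F qop' \<and>
      quandle_hom X qop F qop' \<phi> \<and> \<phi> x \<notin> \<phi> ` T"
    using finite_hub_carrier hub_quandle[OF N(1)] by blast
qed

end

section \<open>Separability of the finitely generated subquandles\<close>

theorem theorem5p9:
  fixes X :: "'a set" and qop :: "'a \<Rightarrow> 'a \<Rightarrow> 'a" and a b :: 'a
  assumes "abelian_quandle X qop"
    and "a \<in> X" and "b \<in> X"
    and "generated_subquandle X qop {a, b} = X"
  shows "subquandle_separable X qop"
proof -
  interpret quandle X qop using assms(1) by (simp add: abelian_quandle_def)
  obtain \<sigma> :: "int \<Rightarrow> 'a" where \<sigma>: "\<sigma> 0 = a" "\<And>k. \<sigma> k \<in> X" "\<And>k. \<sigma> (k + 1) = qop (\<sigma> k) b"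
    using translation_walk[OF assms(2,3)] by blast
  obtain \<tau> :: "int \<Rightarrow> 'a" where \<tau>: "\<tau> 0 = b" "\<And>k. \<tau> k \<in> X" "\<And>k. \<tau> (k + 1) = qop (\<tau> k) a"
    using translation_walk[OF assms(3,2)] by blast
  interpret two_walks X qop \<sigma> \<tau>
    using assms(1,4) \<sigma> \<tau> abelian_quandle_iff by unfold_locales auto
  show ?thesis
    unfolding subquandle_separable_def fin_gen_subquandle_def
  proof (intro allI impI, elim exE conjE)
    fix T G assume G: "finite G" "G \<subseteq> X" and T: "T = generated_subquandle X qop G"
    show "separable X qop T"
    proof (cases "range \<sigma> \<inter> range \<tau> = {}")
      case disj: True
      show ?thesis
      proof (cases rule: generated_cases[OF G(2)])
        case 1
        then show ?thesis using T separable_carrier by simp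
      next
        case 2
        then show ?thesis
          using T G(1) disj finite_subset_walk_separable[of G]
            two_walks.finite_subset_walk_separable[OF swap, of G] by (auto simp: Int_commute)
      qed
    next
      case False
      then obtain i j where "\<sigma> i = \<tau> j" by auto
      then have "X = {\<sigma> 0}" by (rule walks_meet_imp_singleton)
      moreover have "T \<subseteq> X" using T subquandle_generated[OF G(2)] by (simp add: subquandle_def)
      ultimately have "T = {} \<or> T = X" by auto
      then show ?thesis using separable_empty separable_carrier by blast
    qed
  qed
qed

end
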